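(* Let $m,k,n$ be positive integers with $n\le k$, and for $r\in\mathbb{N}$ put $$F_{m,k,n}(r)=\sum_{\substack{A\in B_r^{nk}\\ \mathrm{rank}(A)=n}}\gcd(A)^{-m}.$$ Let $\rho$ be a real number. Then $\rho(SAT(\mathbb{Z}^m,k,n))=\rho$ (i.e. the asymptotic density of $SAT(\mathbb{Z}^m,k,n)$ exists and equals $\rho$) if and only if $$\lim_{r\to\infty}\frac{F_{m,k,n}(r)}{(2r)^{nk}}=\rho .$$
   Context: A system of $n$ equations in $k$ variables over the free abelian group $\mathbb{Z}^m$ is written $AX=B$ with $A\in\mathbb{Z}^{n\times k}$, $B\in\mathbb{Z}^{n\times m}$, and is identified with the integer matrix $(A|B)\in\mathbb{Z}^{n(k+m)}$. It is solvable in $\mathbb{Z}^m$ if there is $X\in\mathbb{Z}^{k\times m}$ with $AX=B$. $SAT(\mathbb{Z}^m,k,n)\subset\mathbb{Z}^{n(k+m)}$ is the set of all $(A|B)$ such that $AX=B$ is solvable in $\mathbb{Z}^m$. For a positive integer $N$ let $\|v\|_\infty=\max_i|v_i|$ and $B_r^N=\{v\in\mathbb{Z}^N:\|v\|_\infty\le r\}$; $B_r^{nk}$ is regarded as the set of $n\times k$ integer matrices with all entries of absolute value at most $r$. For $M\subset\mathbb{Z}^N$ the asymptotic density is $\rho(M)=\lim_{r\to\infty}|M\cap B_r^N|/|B_r^N|$ when the limit exists. For $A\in\mathbb{Z}^{n\times k}$ with $n\le k$ and $\mathrm{rank}(A)=n$, $\gcd(A)$ (the greatest divisor of $A$) denotes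 the greatest common divisor of all $n\times n$ minors of $A$. *)

theory Defs
  imports
    Complex_Main
    Jordan_Normal_Form.DL_Rank
    Jordan_Normal_Form.DL_Submatrix
begin

text \<open>
  \<open>B\<^sub>r\<close> inside \<open>\<int>\<^sup>N\<close> for \<open>N = nr \<cdot> nc\<close>, with \<open>\<int>\<^sup>N\<close> represented as the set of integer
  \<open>nr \<times> nc\<close> matrices.
\<close>

definition int_box :: "nat \<Rightarrow> nat \<Rightarrow> nat \<Rightarrow> int mat set" where
  "int_box nr nc r =
     {A \<in> carrier_mat nr nc. \<forall>i<nr. \<forall>j<nc. \<bar>A $$ (i, j)\<bar> \<le> int r}"

text \<open>The density of \<open>M\<close> as a subset of the integer \<open>nr \<times> nc\<close> matrices exists and equals \<open>d\<close>.\<close>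

definition has_asymptotic_density :: "nat \<Rightarrow> nat \<Rightarrow> int mat set \<Rightarrow> real \<Rightarrow> bool" where
  "has_asymptotic_density nr nc M d \<longleftrightarrow>
     (\<lambda>r. real (card (M \<inter> int_box nr nc r)) / real (card (int_box nr nc r)))
       \<longlonglongrightarrow> d"

text \<open>The augmented matrix \<open>(A|B)\<close>: a block matrix whose lower blocks have no rows.\<close>

definition augmented_mat :: "int mat \<Rightarrow> int mat \<Rightarrow> int mat" where
  "augmented_mat A B = four_block_mat A B (0\<^sub>m 0 (dim_col A)) (0\<^sub>m 0 (dim_col B))"

definition SAT :: "nat \<Rightarrow> nat \<Rightarrow> nat \<Rightarrow> int mat set" where
  "SAT m k n =
     {augmented_mat A B | A B. A \<in> carrier_mat n k \<and> B \<in> carrier_mat n m \<and>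
        (\<exists>X \<in> carrier_mat k m. A * X = B)}"

text \<open>The library defines rank over fields only, so integer matrices are viewed over \<open>\<rat>\<close>.\<close>

definition int_rank :: "int mat \<Rightarrow> nat" where
  "int_rank A = vec_space.rank (dim_row A) (map_mat rat_of_int A)"

text \<open>
  The gcd of the maximal minors; \<open>J\<close> is the set of columns kept, and all rows are kept.
\<close>

definition greatest_divisor :: "int mat \<Rightarrow> int" where
  "greatest_divisor A =
     Gcd {det (submatrix A UNIV J) | J. J \<subseteq> {..<dim_col A} \<and> card J = dim_row A}"

definition gcd_sum :: "nat \<Rightarrow> nat \<Rightarrow> nat \<Rightarrow> nat \<Rightarrow> real" where
  "gcd_sum m k n r =
     (\<Sum>A \<in> {A \<in> int_box n k r. int_rank A = n}.
        real_of_int (greatest_divisor A) powi (- int m))"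

lemma augmented_mat_carrier:
  assumes "A \<in> carrier_mat n k" "B \<in> carrier_mat n m"
  shows "augmented_mat A B \<in> carrier_mat n (k + m)"
  using four_block_carrier_mat[OF assms(1), of "0\<^sub>m 0 (dim_col B)" 0 m] assms
  by (simp add: augmented_mat_def)

lemma augmented_mat_index:
  assumes "A \<in> carrier_mat n k" "B \<in> carrier_mat n m" "i < n" "j < k + m"
  shows "augmented_mat A B $$ (i, j) = (if j < k then A $$ (i, j) else B $$ (i, j - k))"
  using assms by (simp add: augmented_mat_def index_mat_four_block(1))

lemma bij_betw_int_box:
  "bij_betw (\<lambda>f. mat nr nc f)
     (({..<nr} \<times> {..<nc}) \<rightarrow>\<^sub>E {- int r..int r}) (int_box nr nc r)"
proof (rule bij_betw_byWitness[where f' =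
    "\<lambda>A. restrict (\<lambda>ij. A $$ ij) ({..<nr} \<times> {..<nc})"])
  show "\<forall>f\<in>({..<nr} \<times> {..<nc}) \<rightarrow>\<^sub>E {- int r..int r}.
      restrict (\<lambda>ij. mat nr nc f $$ ij) ({..<nr} \<times> {..<nc}) = f"
  proof
    fix f assume "f \<in> ({..<nr} \<times> {..<nc}) \<rightarrow>\<^sub>E {- int r..int r}"
    then have "f \<in> extensional ({..<nr} \<times> {..<nc})"
      by (simp add: PiE_def)
    moreover have "restrict (\<lambda>ij. mat nr nc f $$ ij) ({..<nr} \<times> {..<nc})
        = restrict f ({..<nr} \<times> {..<nc})"
      by (rule restrict_ext) auto
    ultimately show "restrict (\<lambda>ij. mat nr nc f $$ ij) ({..<nr} \<times> {..<nc}) = f"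
      by (simp add: extensional_restrict)
  qed
  show "\<forall>A\<in>int_box nr nc r.
      mat nr nc (restrict (\<lambda>ij. A $$ ij) ({..<nr} \<times> {..<nc})) = A"
  proof
    fix A assume "A \<in> int_box nr nc r"
    then have A: "A \<in> carrier_mat nr nc"
      by (simp add: int_box_def)
    show "mat nr nc (restrict (\<lambda>ij. A $$ ij) ({..<nr} \<times> {..<nc})) = A"
      by (rule eq_matI) (use A in simp_all)
  qed
  show "mat nr nc ` (({..<nr} \<times> {..<nc}) \<rightarrow>\<^sub>E {- int r..int r}) \<subseteq> int_box nr nc r"
  proof (rule image_subsetI)
    fix f assume f: "f \<in> ({..<nr} \<times> {..<nc}) \<rightarrow>\<^sub>E {- int r..int r}"
    have "\<bar>f (i, j)\<bar> \<le> int r" if "i < nr" "j < nc" for i j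
      using PiE_mem[OF f, of "(i, j)"] that by (simp add: abs_le_iff)
    then show "mat nr nc f \<in> int_box nr nc r"
      by (simp add: int_box_def)
  qed
  show "(\<lambda>A. restrict (\<lambda>ij. A $$ ij) ({..<nr} \<times> {..<nc})) ` int_box nr nc r
      \<subseteq> ({..<nr} \<times> {..<nc}) \<rightarrow>\<^sub>E {- int r..int r}"
  proof (rule image_subsetI)
    fix A assume A: "A \<in> int_box nr nc r"
    have "A $$ (i, j) \<in> {- int r..int r}" if "i < nr" "j < nc" for i j
      using A that by (auto simp: int_box_def abs_le_iff minus_le_iff)
    then show "restrict (\<lambda>ij. A $$ ij) ({..<nr} \<times> {..<nc})
        \<in> ({..<nr} \<times> {..<nc}) \<rightarrow>\<^sub>E {- int r..int r}"
      by (intro restrict_PiE_iff[THEN iffD2]) auto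
  qed
qed

lemma finite_int_box: "finite (int_box nr nc r)"
proof -
  have "finite (({..<nr} \<times> {..<nc}) \<rightarrow>\<^sub>E {- int r..int r})"
    by (intro finite_PiE) auto
  then show ?thesis
    using bij_betw_finite[OF bij_betw_int_box] by blast
qed

lemma card_int_box: "card (int_box nr nc r) = (2 * r + 1) ^ (nr * nc)"
proof -
  have "card (({..<nr} \<times> {..<nc}) \<rightarrow>\<^sub>E {- int r..int r})
      = (\<Prod>ij\<in>{..<nr} \<times> {..<nc}. card {- int r..int r})"
    by (rule card_PiE) auto
  also have "\<dots> = card {- int r..int r} ^ (nr * nc)"
    by (simp only: prod_constant card_cartesian_product card_lessThan)
  also have "card {- int r..int r} = 2 * r + 1"
    by simp
  finally show ?thesis
    using bij_betw_same_card[OF bij_betw_int_box, of nr nc r] by argo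
qed

end

theory Submission
  imports Defs "Jordan_Normal_Form.DL_Rank_Submatrix"
begin

text \<open>
  For a coefficient matrix \<open>A\<close> let \<open>L\<close> be the lattice in \<open>\<int>\<^sup>n\<close> generated by its columns, and put
  \<open>N = 2 * r + 1\<close>. The system is solvable for a right-hand side \<open>B\<close> if and only if all \<open>m\<close> columns of
  \<open>B\<close> lie in \<open>L\<close>, so the solvable \<open>(A|B)\<close> in the box number the sum over \<open>A\<close> of the \<open>m\<close>-th power
  of the number of points of \<open>L\<close> in the box of radius \<open>r\<close>. If \<open>L\<close> has rank \<open>n\<close>, its index in
  \<open>\<int>\<^sup>n\<close> is the gcd of \<open>A\<close>, and one expects about \<open>N ^ n\<close> divided by this index many such points;
  replacing the counts by these expected values turns the sum into \<open>gcd_sum\<close>, up to normalization.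

  The difficulty is that the box and the lattices grow together, as the index of \<open>L\<close> can be of order
  \<open>r ^ n\<close>. An estimate for fixed \<open>L\<close> therefore does not suffice; what makes the proof work is the uniform
  estimate \<open>box_density\<close>: the proportion of points of the box that lie in \<open>L\<close> differs from
  \<open>1 / gcd\<close> by at most \<open>n / N\<close>, for every lattice, with \<open>1 / 0 = 0\<close> if the rank is
  less than \<open>n\<close>.

  To see this, take a lower triangular matrix, as in the Hermite normal form, whose columns generate
  \<open>L\<close>. Its diagonal entries \<open>d\<^sub>i\<close> (the pivots) are nonnegative, and their product is the gcd of
  the maximal minors (\<open>greatest_divisor_eq_prod_pivot\<close>). Choosing the coordinates of a point
  of \<open>L\<close> one after the other, the \<open>i\<close>-th coordinate ranges over a residue class modulo \<open>d\<^sub>i\<close> in an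
  interval of \<open>N\<close> integers, which has \<open>N / d\<^sub>i\<close> elements up to an error of at most \<open>1\<close>. As the
  proportions involved never exceed \<open>1\<close>, the relative errors \<open>1 / N\<close> simply add up to \<open>n / N\<close>.

  Taking \<open>m\<close>-th powers of numbers in the unit interval multiplies the error by at most \<open>m\<close>, and
  averaging over \<open>A\<close> keeps it (\<open>SAT_density_approx\<close>). Hence the two sequences of the theorem
  differ by a null sequence, and one converges to a number if and only if the other does.
\<close>

section \<open>Triangular generators of integer lattices\<close>

text \<open>
Bezout's identity for an arbitrary, possibly infinite, ideal of \<open>\<int>\<close>: if it is nonzero, its least
positive element divides all others by Euclidean division, hence is the gcd.
\<close>

lemma Gcd_in_ideal:
  fixes I :: "int set"
  assumes zero: "0 \<in> I" and lin: "\<And>x y c. x \<in> I \<Longrightarrow> y \<in> I \<Longrightarrow> x + c * y \<in> I"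
  shows "Gcd I \<in> I"
proof (cases "I \<subseteq> {0}")
  case True
  then have "I = {0}" using zero by auto
  then show ?thesis by simp
next
  case False
  then obtain z where z: "z \<in> I" "z \<noteq> 0" by auto
  have "- z \<in> I" using lin[OF zero z(1), of "-1"] by simp
  with z have ex: "\<exists>t::nat. t > 0 \<and> int t \<in> I"
    by (intro exI[of _ "nat \<bar>z\<bar>"]) (auto simp: abs_if)
  define e where "e = (LEAST t::nat. t > 0 \<and> int t \<in> I)"
  have e: "e > 0" "int e \<in> I" using LeastI_ex[OF ex] by (auto simp: e_def)
  have "int e dvd x" if x: "x \<in> I" for x
  proof -
    have "x mod int e \<in> I"
      using lin[OF x e(2), of "- (x div int e)"] by (simp add: minus_div_mult_eq_mod)
    moreover obtain s where s: "x mod int e = int s"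
      using e(1) nonneg_int_cases[of "x mod int e"] by auto
    moreover have "s < e"
      using e(1) s pos_mod_bound[of "int e" x] by simp
    ultimately have "s = 0"
      using not_less_Least[of s "\<lambda>t. t > 0 \<and> int t \<in> I", folded e_def] by simp
    then show ?thesis using s by (simp add: dvd_eq_mod_eq_0)
  qed
  then have "int e dvd Gcd I" by (rule Gcd_greatest)
  moreover have "Gcd I dvd int e" using e(2) by (rule Gcd_dvd)
  ultimately have "Gcd I = int e" by (simp add: zdvd_antisym_nonneg)
  with e(2) show ?thesis by simp
qed

lemma mult_unit_vec:
  fixes A :: "int mat"
  assumes "A \<in> carrier_mat nr nc" and "j < nc"
  shows "A *\<^sub>v unit_vec nc j = col A j"
  using assms by (intro eq_vecI) (auto simp: scalar_prod_right_unit)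

lemma mult_mat_vec_smult:
  fixes A :: "int mat"
  assumes "A \<in> carrier_mat nr nc" and "v \<in> carrier_vec nc"
  shows "A *\<^sub>v (c \<cdot>\<^sub>v v) = c \<cdot>\<^sub>v (A *\<^sub>v v)"
  using assms by (intro eq_vecI) auto

text \<open>
Subgroups of \<open>\<int>\<^sup>n\<close> of any rank. Allowing a deficient rank spares a case distinction later: it
only makes some pivots zero.
\<close>

locale zlattice =
  fixes n :: nat and L :: "int vec set"
  assumes carrier: "L \<subseteq> carrier_vec n"
    and zero: "0\<^sub>v n \<in> L"
    and lin: "x \<in> L \<Longrightarrow> y \<in> L \<Longrightarrow> x + c \<cdot>\<^sub>v y \<in> L"
begin

definition tail_sublattice :: "nat \<Rightarrow> int vec set" where
  "tail_sublattice i = {x \<in> L. \<forall>j<i. x $ j = 0}"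

text \<open>
The \<open>i\<close>-th diagonal entry of a Hermite normal form of the lattice. At full rank the product of
these entries is the index of the lattice; below full rank some of them are zero.
\<close>

definition pivot :: "nat \<Rightarrow> int" where
  "pivot i = Gcd ((\<lambda>x. x $ i) ` tail_sublattice i)"

lemma pivot_nonneg: "pivot i \<ge> 0"
  by (simp add: pivot_def)

lemma pivot_dvd: "x \<in> tail_sublattice i \<Longrightarrow> pivot i dvd x $ i"
  by (simp add: pivot_def)

lemma dim_vec_lattice: "x \<in> L \<Longrightarrow> dim_vec x = n"
  using carrier by auto

lemma pivot_attained:
  assumes "i < n"
  shows "\<exists>h \<in> tail_sublattice i. h $ i = pivot i"
proof -
  have "pivot i \<in> (\<lambda>x. x $ i) ` tail_sublattice i"
    unfolding pivot_def
  proof (rule Gcd_in_ideal)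
    show "0 \<in> (\<lambda>x. x $ i) ` tail_sublattice i"
      using zero assms by (auto simp: tail_sublattice_def intro!: image_eqI[of _ _ "0\<^sub>v n"])
    fix a b c assume "a \<in> (\<lambda>x. x $ i) ` tail_sublattice i" "b \<in> (\<lambda>x. x $ i) ` tail_sublattice i"
    then obtain x y where xy: "x \<in> tail_sublattice i" "a = x $ i" "y \<in> tail_sublattice i" "b = y $ i"
      by auto
    with assms have "x + c \<cdot>\<^sub>v y \<in> tail_sublattice i" "(x + c \<cdot>\<^sub>v y) $ i = a + c * b"
      by (auto simp: tail_sublattice_def lin dim_vec_lattice)
    then show "a + c * b \<in> (\<lambda>x. x $ i) ` tail_sublattice i"
      by (metis imageI)
  qed
  then show ?thesis by auto
qed

definition pivot_vec :: "nat \<Rightarrow> int vec" where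
  "pivot_vec i = (SOME h. h \<in> tail_sublattice i \<and> h $ i = pivot i)"

lemma pivot_vec:
  assumes "i < n"
  shows "pivot_vec i \<in> L" "j < i \<Longrightarrow> pivot_vec i $ j = 0" "pivot_vec i $ i = pivot i"
  using someI_ex[OF pivot_attained[OF assms, unfolded Bex_def], folded pivot_vec_def]
  by (auto simp: tail_sublattice_def)

text \<open>
Its columns are lattice vectors that attain the pivots, so it is lower triangular. They always
generate the lattice, but they are linearly dependent as soon as one pivot is zero.
\<close>

definition triangular_generators :: "int mat" where
  "triangular_generators = mat n n (\<lambda>(i, j). pivot_vec j $ i)"

lemma triangular_generators_carrier [simp]: "triangular_generators \<in> carrier_mat n n"
  by (simp add: triangular_generators_def)

lemma col_triangular_generators: "j < n \<Longrightarrow> col triangular_generators j = pivot_vec j"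
  using pivot_vec(1)[of j] by (intro eq_vecI) (auto simp: triangular_generators_def dim_vec_lattice)

lemma det_triangular_generators: "det triangular_generators = (\<Prod>i<n. pivot i)"
proof -
  have "det triangular_generators = prod_list (diag_mat triangular_generators)"
    by (rule det_lower_triangular[OF _ triangular_generators_carrier])
      (simp add: triangular_generators_def pivot_vec)
  also have "\<dots> = (\<Prod>i<n. pivot i)"
    by (simp add: prod_list_diag_prod triangular_generators_def pivot_vec atLeast0LessThan)
  finally show ?thesis .
qed

text \<open>
Forward substitution: the leading coordinates of \<open>x\<close> are cleared one at a time, which is
possible over \<open>\<int>\<close> because the pivot divides the coordinate that is to be cleared.
\<close>

lemma in_span_triangular_generators:
  assumes x: "x \<in> L"
  shows "\<exists>v \<in> carrier_vec n. triangular_generators *\<^sub>v v = x"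
proof -
  have "\<exists>v \<in> carrier_vec n. x - triangular_generators *\<^sub>v v \<in> tail_sublattice i" if "i \<le> n" for i
    using that
  proof (induction i)
    case 0
    have "x - triangular_generators *\<^sub>v 0\<^sub>v n = x"
      using x carrier by (intro eq_vecI) (auto simp: triangular_generators_def scalar_prod_def)
    then show ?case using x by (intro bexI[of _ "0\<^sub>v n"]) (simp_all add: tail_sublattice_def)
  next
    case (Suc i)
    then obtain v where v: "v \<in> carrier_vec n" and y: "x - triangular_generators *\<^sub>v v \<in> tail_sublattice i"
      by auto
    define y where "y = x - triangular_generators *\<^sub>v v"
    obtain t where t: "y $ i = pivot i * t"
      using pivot_dvd[OF y] by (auto simp: y_def dvd_def)
    define w where "w = v + t \<cdot>\<^sub>v unit_vec n i"
    have yL: "y \<in> L" using y by (simp add: y_def tail_sublattice_def)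
    have "triangular_generators *\<^sub>v w = triangular_generators *\<^sub>v v + t \<cdot>\<^sub>v pivot_vec i"
      using v Suc.prems
      by (simp add: w_def mult_add_distrib_mat_vec[of _ n n] mult_mat_vec_smult[of triangular_generators n n]
          mult_unit_vec[of triangular_generators n n] col_triangular_generators)
    then have eq: "x - triangular_generators *\<^sub>v w = y + (- t) \<cdot>\<^sub>v pivot_vec i"
      using Suc.prems x v pivot_vec(1)[of i]
      by (intro eq_vecI) (auto simp: y_def dim_vec_lattice triangular_generators_def)
    have "y + (- t) \<cdot>\<^sub>v pivot_vec i \<in> tail_sublattice (Suc i)"
      using Suc.prems y yL pivot_vec[of i] lin[OF yL pivot_vec(1), of i "- t"]
      by (auto simp: tail_sublattice_def less_Suc_eq t dim_vec_lattice y_def[symmetric])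
    then show ?case using v unfolding eq[symmetric]
      by (intro bexI[of _ w]) (auto simp: w_def)
  qed
  from this[of n] obtain v where v: "v \<in> carrier_vec n" "x - triangular_generators *\<^sub>v v \<in> tail_sublattice n"
    by auto
  have "triangular_generators *\<^sub>v v = x"
  proof (rule eq_vecI)
    show "dim_vec (triangular_generators *\<^sub>v v) = dim_vec x"
      using x by (simp add: dim_vec_lattice triangular_generators_def)
    fix i assume "i < dim_vec x"
    with v x show "(triangular_generators *\<^sub>v v) $ i = x $ i"
      by (auto simp: tail_sublattice_def dim_vec_lattice triangular_generators_def)
  qed
  with v show ?thesis by auto
qed

text \<open>
A square matrix with columns in the lattice is the triangular generating matrix times an integer
matrix, so its determinant is a multiple of the determinant of the former.
\<close>

lemma prod_pivot_dvd_det: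
  assumes M: "M \<in> carrier_mat n n" and cols: "\<And>j. j < n \<Longrightarrow> col M j \<in> L"
  shows "(\<Prod>i<n. pivot i) dvd det M"
proof -
  obtain v where v: "\<And>j. j < n \<Longrightarrow> v j \<in> carrier_vec n \<and> triangular_generators *\<^sub>v v j = col M j"
    using in_span_triangular_generators[OF cols] by metis
  define V where "V = mat n n (\<lambda>(i, j). v j $ i)"
  have colV: "col V j = v j" if "j < n" for j
    using v[OF that] that by (intro eq_vecI) (auto simp: V_def)
  have "M = triangular_generators * V"
  proof (rule mat_col_eqI)
    fix j assume "j < dim_col (triangular_generators * V)"
    then have j: "j < n" by (simp add: V_def)
    have "col (triangular_generators * V) j = triangular_generators *\<^sub>v col V j"
      by (rule col_mult2[of _ n n _ n]) (use j in \<open>auto simp: V_def\<close>)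
    then show "col M j = col (triangular_generators * V) j"
      using v[OF j] colV[OF j] by simp
  qed (use M in \<open>auto simp: V_def triangular_generators_def\<close>)
  then have "det M = det triangular_generators * det V"
    by (simp add: V_def det_mult[of _ n])
  then show ?thesis by (simp add: det_triangular_generators)
qed

end

section \<open>Column lattices and the gcd of the maximal minors\<close>

definition column_lattice :: "int mat \<Rightarrow> int vec set" where
  "column_lattice A = {A *\<^sub>v x | x. x \<in> carrier_vec (dim_col A)}"

lemma zlattice_column_lattice:
  assumes A: "A \<in> carrier_mat n k"
  shows "zlattice n (column_lattice A)"
proof
  show "column_lattice A \<subseteq> carrier_vec n" using A by (auto simp: column_lattice_def)
  have "A *\<^sub>v 0\<^sub>v k = 0\<^sub>v n"
    using A by (intro eq_vecI) (auto simp: scalar_prod_def)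
  then show "0\<^sub>v n \<in> column_lattice A" using A
    unfolding column_lattice_def by (metis (mono_tags, lifting) carrier_matD(2) mem_Collect_eq zero_carrier_vec)
  fix x y c assume "x \<in> column_lattice A" "y \<in> column_lattice A"
  then obtain u v where uv: "u \<in> carrier_vec k" "v \<in> carrier_vec k" "x = A *\<^sub>v u" "y = A *\<^sub>v v"
    using A by (auto simp: column_lattice_def)
  then have "x + c \<cdot>\<^sub>v y = A *\<^sub>v (u + c \<cdot>\<^sub>v v)"
    using A by (simp add: mult_add_distrib_mat_vec[of _ n k] mult_mat_vec_smult[of A n k])
  with uv A show "x + c \<cdot>\<^sub>v y \<in> column_lattice A"
    unfolding column_lattice_def by (intro CollectI exI[of _ "u + c \<cdot>\<^sub>v v"]) auto
qed

lemma col_in_column_lattice: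
  assumes A: "A \<in> carrier_mat n k" and "j < k"
  shows "col A j \<in> column_lattice A"
  using mult_unit_vec[OF assms] A unfolding column_lattice_def
  by (intro CollectI exI[of _ "unit_vec k j"]) auto

text \<open>
The columns may be selected in any order and with repetition. In every case they lie among the
columns of some maximal submatrix with column set \<open>J\<close>, so the selection is that submatrix times a
0-1 matrix, and no sign of a permutation has to be computed.
\<close>

lemma dvd_det_selected_cols:
  fixes A :: "int mat"
  assumes A: "A \<in> carrier_mat n k" and "n \<le> k" and f: "\<And>j. j < n \<Longrightarrow> f j < k"
  shows "greatest_divisor A dvd det (mat n n (\<lambda>(i, j). A $$ (i, f j)))"
proof -
  have "card (f ` {..<n}) \<le> n" using card_image_le[of "{..<n}" f] by simp
  moreover have "f ` {..<n} \<subseteq> {..<k}" using f by auto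
  ultimately obtain J where J: "f ` {..<n} \<subseteq> J" "J \<subseteq> {..<k}" "card J = n"
    using exists_subset_between[of "f ` {..<n}" n "{..<k}"] \<open>n \<le> k\<close> by auto
  have cardJ: "card {j. j < dim_col A \<and> j \<in> J} = n"
  proof -
    have "{j. j < dim_col A \<and> j \<in> J} = J" using J A by auto
    then show ?thesis using J by simp
  qed
  let ?S = "submatrix A UNIV J"
  have S: "?S \<in> carrier_mat n n"
    using A cardJ by (intro carrier_matI) (simp_all add: dim_submatrix)
  \<comment> \<open>\<open>card {a \<in> J. a < f j}\<close> is the position of column \<open>f j\<close> within the submatrix.\<close>
  define P where "P = mat n n (\<lambda>(l, j). if l = card {a \<in> J. a < f j} then 1 else 0 :: int)"
  have pos: "card {a \<in> J. a < f j} < n" if "j < n" for j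
  proof -
    have "{a \<in> J. a < f j} \<subset> J" using J that by auto
    then have "card {a \<in> J. a < f j} < card J"
      using J finite_subset[of J "{..<k}"] by (intro psubset_card_mono) auto
    then show ?thesis using J by simp
  qed
  have "mat n n (\<lambda>(i, j). A $$ (i, f j)) = ?S * P"
  proof (rule eq_matI)
    fix i j assume ij: "i < dim_row (?S * P)" "j < dim_col (?S * P)"
    then have ij: "i < n" "j < n" using S by (auto simp: P_def)
    have fJ: "f j \<in> J" using J ij by auto
    have "(?S * P) $$ (i, j) = (\<Sum>l<n. ?S $$ (i, l) * (if l = card {a \<in> J. a < f j} then 1 else 0))"
      using S ij by (simp add: scalar_prod_def P_def atLeast0LessThan)
    also have "\<dots> = ?S $$ (i, card {a \<in> J. a < f j})"
      using pos[OF ij(2)] by (simp add: if_distrib sum.delta cong: if_cong)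
    also have "\<dots> = A $$ (pick UNIV i, pick J (card {a \<in> J. a < f j}))"
      by (rule submatrix_index) (use cardJ pos[OF ij(2)] ij A in auto)
    also have "\<dots> = A $$ (i, f j)"
      by (simp add: pick_UNIV pick_card_in_set[OF fJ])
    finally show "mat n n (\<lambda>(i, j). A $$ (i, f j)) $$ (i, j) = (?S * P) $$ (i, j)"
      using ij by simp
  qed (use S in \<open>auto simp: P_def\<close>)
  then have "det (mat n n (\<lambda>(i, j). A $$ (i, f j))) = det ?S * det P"
    using det_mult[OF S, of P] by (simp add: P_def)
  moreover have "greatest_divisor A dvd det ?S"
    unfolding greatest_divisor_def using J A by (intro Gcd_dvd) auto
  ultimately show ?thesis by simp
qed

text \<open>
The divisibility that the Cauchy-Binet formula would give. Expanding \<open>det (A * V)\<close> multilinearly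
in its columns leaves integer multiples of determinants of selected columns of \<open>A\<close>.
\<close>

lemma greatest_divisor_dvd_det_mult:
  assumes A: "A \<in> carrier_mat n k" and "n \<le> k" and V: "V \<in> carrier_mat k n"
  shows "greatest_divisor A dvd det (A * V)"
proof -
  let ?F = "{f. (\<forall>i\<in>{0..<n}. f i \<in> {0..<k}) \<and> (\<forall>i. i \<notin> {0..<n} \<longrightarrow> f i = i)}"
  \<comment> \<open>The multilinear expansion is along rows, so the product is transposed.\<close>
  have "det (A * V) = det (transpose_mat V * transpose_mat A)"
    using A V by (simp add: det_transpose[of _ n] transpose_mult[symmetric, of A n k V n])
  also have "transpose_mat V * transpose_mat A =
      mat\<^sub>r n n (\<lambda>i. finsum_vec TYPE(int) n (\<lambda>l. V $$ (l, i) \<cdot>\<^sub>v col A l) {0..<k})"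
    by (subst mat_mul_finsum_alt[of _ n k _ n]) (use A V in \<open>auto intro!: eq_matI simp: index_finsum_vec\<close>)
  also have "det \<dots> = (\<Sum>f\<in>?F. det (mat\<^sub>r n n (\<lambda>i. V $$ (f i, i) \<cdot>\<^sub>v col A (f i))))"
    by (rule det_linear_rows_sum) (use A in auto)
  also have "greatest_divisor A dvd \<dots>"
  proof (rule dvd_sum)
    fix f assume f: "f \<in> ?F"
    have "det (mat\<^sub>r n n (\<lambda>i. V $$ (f i, i) \<cdot>\<^sub>v col A (f i)))
        = (\<Prod>i = 0..<n. V $$ (f i, i)) * det (mat\<^sub>r n n (\<lambda>i. col A (f i)))"
      by (rule det_rows_mul) (use A in auto)
    also have "mat\<^sub>r n n (\<lambda>i. col A (f i)) = transpose_mat (mat n n (\<lambda>(i, j). A $$ (i, f j)))"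
      using A f by (intro eq_matI) auto
    also have "det \<dots> = det (mat n n (\<lambda>(i, j). A $$ (i, f j)))"
      by (rule det_transpose[of _ n]) simp
    finally show "greatest_divisor A dvd det (mat\<^sub>r n n (\<lambda>i. V $$ (f i, i) \<cdot>\<^sub>v col A (f i)))"
      using dvd_det_selected_cols[OF A \<open>n \<le> k\<close>, of f] f by simp
  qed
  finally show ?thesis .
qed

text \<open>
Both sides divide each other: the triangular generating matrix has the form \<open>A * V\<close>, and the
maximal submatrices of \<open>A\<close> have their columns in the lattice. The right-hand side depends only on
the lattice; when it is nonzero, it is the index of the lattice in \<open>\<int>\<^sup>n\<close>.
\<close>

lemma greatest_divisor_eq_prod_pivot:
  assumes A: "A \<in> carrier_mat n k" and "n \<le> k"
  shows "greatest_divisor A = (\<Prod>i<n. zlattice.pivot (column_lattice A) i)"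
proof -
  interpret zlattice n "column_lattice A" by (rule zlattice_column_lattice[OF A])
  have "\<exists>v. v \<in> carrier_vec k \<and> pivot_vec j = A *\<^sub>v v" if "j < n" for j
    using pivot_vec(1)[OF that] A by (auto simp: column_lattice_def)
  then obtain v where v: "\<And>j. j < n \<Longrightarrow> v j \<in> carrier_vec k \<and> pivot_vec j = A *\<^sub>v v j"
    by metis
  define V where "V = mat k n (\<lambda>(i, j). v j $ i)"
  have V: "V \<in> carrier_mat k n" by (simp add: V_def)
  have "triangular_generators = A * V"
  proof (rule mat_col_eqI)
    fix j assume "j < dim_col (A * V)"
    then have j: "j < n" by (simp add: V_def)
    have "col V j = v j" using v[OF j] j by (intro eq_vecI) (auto simp: V_def)
    then show "col triangular_generators j = col (A * V) j"
      using v[OF j] col_triangular_generators[OF j] col_mult2[OF A V j] by simp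
  qed (use A in \<open>auto simp: V_def triangular_generators_def\<close>)
  then have "greatest_divisor A dvd (\<Prod>i<n. pivot i)"
    using greatest_divisor_dvd_det_mult[OF A \<open>n \<le> k\<close> V] by (metis det_triangular_generators)
  moreover have "(\<Prod>i<n. pivot i) dvd greatest_divisor A"
    unfolding greatest_divisor_def
  proof (rule Gcd_greatest, clarify)
    fix J assume J: "J \<subseteq> {..<dim_col A}" "card J = dim_row A"
    then have "{j. j < dim_col A \<and> j \<in> J} = J" by auto
    with J A have cardJ: "card {j. j < dim_col A \<and> j \<in> J} = n" by simp
    let ?S = "submatrix A UNIV J"
    have S: "?S \<in> carrier_mat n n"
      using A cardJ by (intro carrier_matI) (simp_all add: dim_submatrix)
    show "(\<Prod>i<n. pivot i) dvd det ?S"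
    proof (rule prod_pivot_dvd_det[OF S])
      fix j assume j: "j < n"
      then have pk: "pick J j < k" using pick_le[of j k J] cardJ A by auto
      have "col ?S j = col A (pick J j)"
      proof (rule eq_vecI)
        fix i assume "i < dim_vec (col A (pick J j))"
        then have i: "i < n" using A by simp
        show "col ?S j $ i = col A (pick J j) $ i"
          using S A i j pk cardJ submatrix_index[of i A UNIV j J] by (simp add: pick_UNIV)
      qed (use S A in auto)
      with col_in_column_lattice[OF A pk] show "col ?S j \<in> column_lattice A" by simp
    qed
  qed
  moreover have "(\<Prod>i<n. pivot i) \<ge> 0" by (simp add: prod_nonneg pivot_nonneg)
  moreover have "greatest_divisor A \<ge> 0" by (simp add: greatest_divisor_def)
  ultimately show ?thesis by (simp add: zdvd_antisym_nonneg)
qed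

lemma (in vec_space) rank_le_nr:
  assumes "A \<in> carrier_mat n nc"
  shows "rank A \<le> n"
proof -
  have "set (cols A) \<subseteq> carrier_vec n" using cols_dim assms by blast
  then have "VectorSpace.subspace class_ring (span (set (cols A))) V"
    by (intro span_is_subspace) auto
  from subspace_dim[OF this fin_dim fin_dim_span_cols[OF assms]]
  show ?thesis by (simp add: rank_def dim_is_n)
qed

text \<open>
A nonzero gcd has a nonzero maximal minor behind it, which forces full rank over \<open>\<rat>\<close>.
\<close>

lemma greatest_divisor_eq_0_if_rank_deficient:
  assumes A: "A \<in> carrier_mat n k" and r: "int_rank A \<noteq> n"
  shows "greatest_divisor A = 0"
proof (rule ccontr)
  assume "greatest_divisor A \<noteq> 0"
  then obtain J where J: "J \<subseteq> {..<k}" "card J = n" "det (submatrix A UNIV J) \<noteq> 0"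
    using A unfolding greatest_divisor_def by (auto simp: Gcd_0_iff)
  have JA: "{j. j < k \<and> j \<in> J} = J" using J by auto
  let ?A = "map_mat rat_of_int A"
  have A': "?A \<in> carrier_mat n k" using A by simp
  have "submatrix ?A UNIV J = map_mat rat_of_int (submatrix A UNIV J)"
  proof (rule eq_matI)
    fix i j assume "i < dim_row (map_mat rat_of_int (submatrix A UNIV J))"
      "j < dim_col (map_mat rat_of_int (submatrix A UNIV J))"
    then have ij: "i < n" "j < card {j. j < k \<and> j \<in> J}" using A by (auto simp: dim_submatrix)
    then have "pick J j < k" using pick_le[of j k J] by blast
    with ij show "submatrix ?A UNIV J $$ (i, j) = map_mat rat_of_int (submatrix A UNIV J) $$ (i, j)"
      using A by (simp add: submatrix_def pick_UNIV)
  qed (simp_all add: dim_submatrix)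
  then have "det (submatrix ?A UNIV J) \<noteq> 0"
    using J(3) by (simp add: of_int_hom.hom_det)
  from vec_space.rank_gt_minor[OF A' this] have "n \<le> int_rank A"
    using A J JA by (simp add: int_rank_def)
  moreover have "int_rank A \<le> n"
    using vec_space.rank_le_nr[OF A'] A by (simp add: int_rank_def)
  ultimately show False using r by simp
qed

section \<open>Lattice points in a box\<close>

lemma le_div_iff_mult_le:
  fixes s x d :: int
  assumes "d > 0"
  shows "s \<le> x div d \<longleftrightarrow> s * d \<le> x"
proof
  assume "s \<le> x div d"
  then have "s * d \<le> x div d * d" using assms by (intro mult_right_mono) auto
  also have "\<dots> \<le> x" using div_mult_mod_eq[of x d] pos_mod_sign[OF assms, of x] by linarith
  finally show "s * d \<le> x" .
next
  assume "s * d \<le> x"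
  from zdiv_mono1[OF this assms] assms show "s \<le> x div d" by simp
qed

text \<open>
For \<open>d = 0\<close> the quotient \<open>(2 * real r + 1) / of_int d\<close> is zero, and the set has at most one
element, so the estimate covers zero pivots as well.
\<close>

lemma card_residue_class_interval:
  fixes a d :: int
  assumes "d \<ge> 0"
  shows "\<bar>real (card {t. \<bar>t\<bar> \<le> int r \<and> d dvd t - a}) - (2 * real r + 1) / of_int d\<bar> \<le> 1"
proof (cases "d = 0")
  case True
  then have "{t. \<bar>t\<bar> \<le> int r \<and> d dvd t - a} \<subseteq> {a}" by auto
  then have "card {t. \<bar>t\<bar> \<le> int r \<and> d dvd t - a} \<le> 1"
    using card_mono[of "{a}"] by simp
  then show ?thesis using True by simp
next
  case False
  with assms have d: "d > 0" by simp
  \<comment> \<open>The elements are \<open>a + d * s\<close> with \<open>l < s \<le> u\<close>; the bound \<open>- r \<le> a + d * s\<close> becomes the strict inequality \<open>l < s\<close>.\<close>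
  define u where "u = (int r - a) div d"
  define l where "l = (- int r - a - 1) div d"
  have "bij_betw (\<lambda>s. a + d * s) {l<..u} {t. \<bar>t\<bar> \<le> int r \<and> d dvd t - a}"
  proof (rule bij_betw_imageI)
    show "inj_on (\<lambda>s. a + d * s) {l<..u}" using d by (auto simp: inj_on_def)
    have iff: "s \<in> {l<..u} \<longleftrightarrow> \<bar>a + d * s\<bar> \<le> int r" for s
    proof -
      have "s \<le> u \<longleftrightarrow> s * d \<le> int r - a"
        unfolding u_def using d by (rule le_div_iff_mult_le)
      moreover have "s \<le> l \<longleftrightarrow> s * d \<le> - int r - a - 1"
        unfolding l_def using d by (rule le_div_iff_mult_le)
      ultimately show ?thesis by (auto simp: mult.commute abs_le_iff not_le)
    qed
    show "(\<lambda>s. a + d * s) ` {l<..u} = {t. \<bar>t\<bar> \<le> int r \<and> d dvd t - a}"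
    proof (intro equalityI subsetI)
      fix t assume "t \<in> {t. \<bar>t\<bar> \<le> int r \<and> d dvd t - a}"
      then obtain s where "\<bar>t\<bar> \<le> int r" "t - a = d * s" by auto
      then have "t = a + d * s" "s \<in> {l<..u}" using iff[of s] by auto
      then show "t \<in> (\<lambda>s. a + d * s) ` {l<..u}" by blast
    next
      fix t assume "t \<in> (\<lambda>s. a + d * s) ` {l<..u}"
      then obtain s where "s \<in> {l<..u}" "t = a + d * s" by blast
      then show "t \<in> {t. \<bar>t\<bar> \<le> int r \<and> d dvd t - a}" using iff[of s] by simp
    qed
  qed
  then have "card {t. \<bar>t\<bar> \<le> int r \<and> d dvd t - a} = nat (u - l)"
    using bij_betw_same_card by fastforce
  moreover have "l \<le> u" unfolding l_def u_def using d by (intro zdiv_mono1) auto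
  ultimately have "real (card {t. \<bar>t\<bar> \<le> int r \<and> d dvd t - a}) = of_int u - of_int l"
    by simp
  moreover have "of_int (x div d) \<le> (of_int x / of_int d :: real)"
    "of_int x / of_int d - 1 < (of_int (x div d) :: real)" for x
    using floor_divide_of_int_eq[of x d, where 'a = real]
      of_int_floor_le[of "real_of_int x / of_int d"] floor_correct[of "real_of_int x / of_int d"]
    by linarith+
  from this[of "int r - a"] this[of "- int r - a - 1"]
  have "of_int u \<le> (real r - of_int a) / of_int d" "(real r - of_int a) / of_int d - 1 < of_int u"
    "of_int l \<le> (- real r - of_int a - 1) / of_int d" "(- real r - of_int a - 1) / of_int d - 1 < of_int l"
    by (simp_all add: u_def l_def)
  moreover have "(real r - of_int a) / of_int d - (- real r - of_int a - 1) / of_int d = (2 * real r + 1) / of_int d"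
    by (simp add: diff_divide_distrib[symmetric])
  ultimately show ?thesis by linarith
qed

context zlattice
begin

text \<open>
Only the first \<open>i\<close> coordinates of the lattice vector are required to be bounded. This makes the
extensions of a prefix by one more coordinate a full residue class within the interval; prefixes of
lattice points of the whole box would not have this property.
\<close>

definition box_prefixes :: "nat \<Rightarrow> nat \<Rightarrow> int vec set" where
  "box_prefixes r i = (\<lambda>x. vec i (\<lambda>j. x $ j)) ` {x \<in> L. \<forall>j<i. \<bar>x $ j\<bar> \<le> int r}"

definition extensions :: "nat \<Rightarrow> nat \<Rightarrow> int vec \<Rightarrow> int set" where
  "extensions r i p = {x $ i | x. x \<in> L \<and> vec i (\<lambda>j. x $ j) = p \<and> \<bar>x $ i\<bar> \<le> int r}"

text \<open>
Two lattice vectors with the same first \<open>i\<close> coordinates differ by a vector whose coordinate \<open>i\<close>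
is a multiple of the pivot. Conversely, adding multiples of the vector that attains the pivot
leaves the prefix unchanged.
\<close>

lemma extensions_eq:
  assumes "i < n" and p: "p \<in> box_prefixes r i"
  shows "\<exists>a. extensions r i p = {t. \<bar>t\<bar> \<le> int r \<and> pivot i dvd t - a}"
proof -
  obtain x0 where x0: "x0 \<in> L" "p = vec i (\<lambda>j. x0 $ j)"
    using p by (auto simp: box_prefixes_def)
  have "extensions r i p = {t. \<bar>t\<bar> \<le> int r \<and> pivot i dvd t - x0 $ i}"
  proof (intro equalityI subsetI)
    fix t assume "t \<in> extensions r i p"
    then obtain x where x: "x \<in> L" "vec i (\<lambda>j. x $ j) = p" "t = x $ i" "\<bar>t\<bar> \<le> int r"
      by (auto simp: extensions_def)
    have eq: "x $ j = x0 $ j" if "j < i" for j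
      using x(2) x0(2) that by (metis index_vec)
    have "x + (- 1) \<cdot>\<^sub>v x0 \<in> tail_sublattice i"
      using lin[OF x(1) x0(1), of "- 1"] eq \<open>i < n\<close> x(1) x0(1)
      by (simp add: tail_sublattice_def dim_vec_lattice)
    from pivot_dvd[OF this] show "t \<in> {t. \<bar>t\<bar> \<le> int r \<and> pivot i dvd t - x0 $ i}"
      using x x0 \<open>i < n\<close> by (simp add: dim_vec_lattice)
  next
    fix t assume "t \<in> {t. \<bar>t\<bar> \<le> int r \<and> pivot i dvd t - x0 $ i}"
    then obtain c where t: "\<bar>t\<bar> \<le> int r" "t - x0 $ i = pivot i * c" by (auto simp: dvd_def)
    let ?x = "x0 + c \<cdot>\<^sub>v pivot_vec i"
    have "?x \<in> L" using lin[OF x0(1) pivot_vec(1)[OF \<open>i < n\<close>]] .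
    moreover have "vec i (\<lambda>j. ?x $ j) = p"
      unfolding x0(2) using x0(1) pivot_vec(1,2)[OF \<open>i < n\<close>] \<open>i < n\<close>
      by (intro eq_vecI) (auto simp: dim_vec_lattice)
    moreover have "?x $ i = t"
      using x0(1) pivot_vec(1,3)[OF \<open>i < n\<close>] \<open>i < n\<close> t by (simp add: dim_vec_lattice mult.commute)
    ultimately show "t \<in> extensions r i p" using t unfolding extensions_def by blast
  qed
  then show ?thesis by blast
qed

lemma finite_extensions: "finite (extensions r i p)"
  and card_extensions_le: "card (extensions r i p) \<le> 2 * r + 1"
proof -
  have sub: "extensions r i p \<subseteq> {- int r..int r}" by (auto simp: extensions_def)
  then show "finite (extensions r i p)" by (rule finite_subset) simp
  show "card (extensions r i p) \<le> 2 * r + 1"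
    using card_mono[OF _ sub] by simp
qed

lemma bij_betw_prefixes_Suc:
  "bij_betw (\<lambda>p. (vec i (\<lambda>j. p $ j), p $ i)) (box_prefixes r (Suc i))
     (Sigma (box_prefixes r i) (extensions r i))"
proof (rule bij_betw_imageI)
  show "inj_on (\<lambda>p. (vec i (\<lambda>j. p $ j), p $ i)) (box_prefixes r (Suc i))"
  proof (rule inj_onI)
    fix p q assume pq: "p \<in> box_prefixes r (Suc i)" "q \<in> box_prefixes r (Suc i)"
      "(vec i (\<lambda>j. p $ j), p $ i) = (vec i (\<lambda>j. q $ j), q $ i)"
    then have "p $ j = q $ j" if "j < i" for j using that by (metis index_vec prod.inject)
    with pq show "p = q"
      by (intro eq_vecI) (auto simp: box_prefixes_def less_Suc_eq)
  qed
  have trunc: "vec i (\<lambda>j. vec (Suc i) (\<lambda>j. x $ j) $ j) = vec i (\<lambda>j. x $ j)" for x :: "int vec"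
    by (intro eq_vecI) auto
  show "(\<lambda>p. (vec i (\<lambda>j. p $ j), p $ i)) ` box_prefixes r (Suc i)
      = Sigma (box_prefixes r i) (extensions r i)"
  proof (intro equalityI subsetI)
    fix z assume "z \<in> (\<lambda>p. (vec i (\<lambda>j. p $ j), p $ i)) ` box_prefixes r (Suc i)"
    then obtain x where "x \<in> L" "\<forall>j<Suc i. \<bar>x $ j\<bar> \<le> int r" "z = (vec i (\<lambda>j. x $ j), x $ i)"
      by (auto simp: box_prefixes_def trunc)
    then show "z \<in> Sigma (box_prefixes r i) (extensions r i)"
      by (auto simp: box_prefixes_def extensions_def)
  next
    fix z assume "z \<in> Sigma (box_prefixes r i) (extensions r i)"
    then obtain y x where y: "\<forall>j<i. \<bar>y $ j\<bar> \<le> int r" and x: "x \<in> L" "\<bar>x $ i\<bar> \<le> int r"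
      and xy: "vec i (\<lambda>j. x $ j) = vec i (\<lambda>j. y $ j)" and z: "z = (vec i (\<lambda>j. x $ j), x $ i)"
      by (auto simp: box_prefixes_def extensions_def)
    have "x $ j = y $ j" if "j < i" for j using xy that by (metis index_vec)
    with x y have "vec (Suc i) (\<lambda>j. x $ j) \<in> box_prefixes r (Suc i)"
      by (auto simp: box_prefixes_def less_Suc_eq)
    then show "z \<in> (\<lambda>p. (vec i (\<lambda>j. p $ j), p $ i)) ` box_prefixes r (Suc i)"
      by (rule rev_image_eqI) (simp add: z trunc)
  qed
qed

lemma box_prefixes_0: "box_prefixes r 0 = {vec 0 undefined}"
  using zero by (auto simp: box_prefixes_def intro!: eq_vecI)

lemma finite_box_prefixes: "finite (box_prefixes r i)"
proof (induction i)
  case 0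
  then show ?case by (simp add: box_prefixes_0)
next
  case (Suc i)
  then show ?case
    using bij_betw_finite[OF bij_betw_prefixes_Suc] finite_extensions by blast
qed

lemma card_box_prefixes_Suc:
  "card (box_prefixes r (Suc i)) = (\<Sum>p\<in>box_prefixes r i. card (extensions r i p))"
  using bij_betw_same_card[OF bij_betw_prefixes_Suc, of r i]
  by (simp add: card_SigmaI finite_box_prefixes finite_extensions)

lemma card_box_prefixes_le: "card (box_prefixes r i) \<le> (2 * r + 1) ^ i"
proof (induction i)
  case 0
  then show ?case by (simp add: box_prefixes_0)
next
  case (Suc i)
  have "card (box_prefixes r (Suc i)) \<le> (\<Sum>p\<in>box_prefixes r i. 2 * r + 1)"
    unfolding card_box_prefixes_Suc by (intro sum_mono card_extensions_le)
  also have "\<dots> \<le> (2 * r + 1) ^ Suc i"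
    using mult_le_mono1[OF Suc, of "2 * r + 1"] by (simp only: sum_constant power_Suc2 of_nat_id)
  finally show ?case .
qed

lemma card_box_prefixes_Suc_approx:
  assumes "i < n"
  shows "\<bar>real (card (box_prefixes r (Suc i)))
      - real (card (box_prefixes r i)) * ((2 * real r + 1) / of_int (pivot i))\<bar>
    \<le> real (card (box_prefixes r i))"
proof -
  let ?c = "(2 * real r + 1) / of_int (pivot i)"
  have "real (card (box_prefixes r (Suc i))) - real (card (box_prefixes r i)) * ?c
      = (\<Sum>p\<in>box_prefixes r i. real (card (extensions r i p)) - ?c)"
    by (simp add: card_box_prefixes_Suc sum_subtractf)
  also have "\<bar>\<dots>\<bar> \<le> (\<Sum>p\<in>box_prefixes r i. \<bar>real (card (extensions r i p)) - ?c\<bar>)"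
    by (rule sum_abs)
  also have "\<dots> \<le> (\<Sum>p\<in>box_prefixes r i. 1)"
  proof (rule sum_mono)
    fix p assume "p \<in> box_prefixes r i"
    then obtain a where "extensions r i p = {t. \<bar>t\<bar> \<le> int r \<and> pivot i dvd t - a}"
      using extensions_eq[OF assms] by blast
    then show "\<bar>real (card (extensions r i p)) - ?c\<bar> \<le> 1"
      using card_residue_class_interval[OF pivot_nonneg] by simp
  qed
  finally show ?thesis by simp
qed

text \<open>
Each further coordinate multiplies the density of prefixes by \<open>1 / pivot i\<close> up to an error of
\<open>1 / (2 * real r + 1)\<close>. Earlier errors do not grow, because \<open>1 / pivot i \<le> 1\<close>.
\<close>

lemma box_prefixes_density:
  assumes "i \<le> n"
  shows "\<bar>real (card (box_prefixes r i)) / (2 * real r + 1) ^ i - 1 / of_int (\<Prod>j<i. pivot j)\<bar>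
    \<le> real i / (2 * real r + 1)"
  using assms
proof (induction i)
  case 0
  then show ?case by (simp add: box_prefixes_0)
next
  case (Suc i)
  define N where "N = 2 * real r + 1"
  have N: "N > 0" by (simp add: N_def)
  define p where "p = real (card (box_prefixes r i)) / N ^ i"
  define p' where "p' = real (card (box_prefixes r (Suc i))) / N ^ Suc i"
  define c :: real where "c = 1 / of_int (pivot i)"
  define q :: real where "q = 1 / of_int (\<Prod>j<i. pivot j)"
  have c: "0 \<le> c" "c \<le> 1"
    using pivot_nonneg[of i] by (cases "pivot i = 0"; simp add: c_def)+
  have "real (card (box_prefixes r i)) \<le> real ((2 * r + 1) ^ i)"
    using card_box_prefixes_le of_nat_le_iff by blast
  also have "\<dots> = N ^ i" by (simp add: N_def add.commute)
  finally have p1: "p \<le> 1" using N by (simp add: p_def)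
  have "p' - p * c
      = (real (card (box_prefixes r (Suc i))) - real (card (box_prefixes r i)) * (N * c)) / N ^ Suc i"
    using N by (simp add: p'_def p_def field_simps)
  also have "\<bar>\<dots>\<bar> \<le> real (card (box_prefixes r i)) / N ^ Suc i"
    using card_box_prefixes_Suc_approx[of i r] Suc.prems N
    by (simp add: abs_divide N_def[symmetric] c_def divide_right_mono)
  also have "\<dots> = p / N" by (simp add: p_def)
  also have "\<dots> \<le> 1 / N" using p1 N by (simp add: divide_right_mono)
  finally have 1: "\<bar>p' - p * c\<bar> \<le> 1 / N" .
  have "\<bar>p * c - q * c\<bar> = \<bar>p - q\<bar> * c"
    using c by (simp add: left_diff_distrib[symmetric] abs_mult)
  also have "\<dots> \<le> \<bar>p - q\<bar>" using c by (simp add: mult_left_le)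
  also have "\<dots> \<le> real i / N"
    using Suc by (simp add: p_def q_def N_def)
  finally have "\<bar>p' - q * c\<bar> \<le> real i / N + 1 / N" using 1 by linarith
  also have "\<dots> = real (Suc i) / N" by (simp add: add_divide_distrib)
  finally show ?case by (simp add: p'_def q_def c_def N_def)
qed

lemma box_prefixes_full: "box_prefixes r n = {x \<in> L. \<forall>j<n. \<bar>x $ j\<bar> \<le> int r}"
proof -
  have "box_prefixes r n = id ` {x \<in> L. \<forall>j<n. \<bar>x $ j\<bar> \<le> int r}"
    unfolding box_prefixes_def
    by (rule image_cong) (auto intro!: eq_vecI simp: dim_vec_lattice)
  then show ?thesis by simp
qed

lemma box_card_le: "card {x \<in> L. \<forall>j<n. \<bar>x $ j\<bar> \<le> int r} \<le> (2 * r + 1) ^ n"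
  using card_box_prefixes_le[of r n] by (simp only: box_prefixes_full)

text \<open>
The error term does not depend on the lattice. This uniformity is what allows averaging over all
matrices in a growing box, whose lattices have unbounded index.
\<close>

lemma box_density:
  "\<bar>real (card {x \<in> L. \<forall>j<n. \<bar>x $ j\<bar> \<le> int r}) / (2 * real r + 1) ^ n
      - 1 / of_int (\<Prod>j<n. pivot j)\<bar> \<le> real n / (2 * real r + 1)"
  using box_prefixes_density[of n r] by (simp only: box_prefixes_full order_refl simp_thms)

end

section \<open>Solvable systems in a box\<close>

definition solvable_rhs :: "nat \<Rightarrow> int mat \<Rightarrow> nat \<Rightarrow> int mat set" where
  "solvable_rhs m A r =
     {B \<in> int_box (dim_row A) m r. \<exists>X \<in> carrier_mat (dim_col A) m. A * X = B}"

lemma mult_mat_cols: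
  fixes A :: "int mat"
  assumes A: "A \<in> carrier_mat n k" and v: "\<And>j. j < m \<Longrightarrow> v j \<in> carrier_vec k"
  shows "A * mat k m (\<lambda>(i, j). v j $ i) = mat n m (\<lambda>(i, j). (A *\<^sub>v v j) $ i)"
proof (rule eq_matI)
  fix i j assume "i < dim_row (mat n m (\<lambda>(i, j). (A *\<^sub>v v j) $ i))"
    "j < dim_col (mat n m (\<lambda>(i, j). (A *\<^sub>v v j) $ i))"
  then have ij: "i < n" "j < m" by auto
  have "col (mat k m (\<lambda>(i, j). v j $ i)) j = v j"
    using v[OF ij(2)] ij by (intro eq_vecI) auto
  then show "(A * mat k m (\<lambda>(i, j). v j $ i)) $$ (i, j)
      = mat n m (\<lambda>(i, j). (A *\<^sub>v v j) $ i) $$ (i, j)"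
    using ij A by simp
qed (use A in auto)

text \<open>
The system is solved column by column, so each column of the right-hand side ranges independently
over the points of the column lattice in the box.
\<close>

lemma card_solvable_rhs:
  assumes A: "A \<in> carrier_mat n k"
  shows "card (solvable_rhs m A r) = card {x \<in> column_lattice A. \<forall>j<n. \<bar>x $ j\<bar> \<le> int r} ^ m"
proof -
  let ?S = "{x \<in> column_lattice A. \<forall>j<n. \<bar>x $ j\<bar> \<le> int r}"
  have S_carrier: "x \<in> carrier_vec n" if "x \<in> ?S" for x
    using that A by (auto simp: column_lattice_def)
  have "bij_betw (\<lambda>B. restrict (col B) {..<m}) (solvable_rhs m A r) ({..<m} \<rightarrow>\<^sub>E ?S)"
  proof (rule bij_betw_imageI)
    show "inj_on (\<lambda>B. restrict (col B) {..<m}) (solvable_rhs m A r)"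
    proof (rule inj_onI)
      fix B C assume B: "B \<in> solvable_rhs m A r" and C: "C \<in> solvable_rhs m A r"
        and eq: "restrict (col B) {..<m} = restrict (col C) {..<m}"
      have "col B j = col C j" if "j < m" for j
        using fun_cong[OF eq, of j] that by simp
      then show "B = C"
        using B C by (intro mat_col_eqI) (auto simp: solvable_rhs_def int_box_def)
    qed
    show "(\<lambda>B. restrict (col B) {..<m}) ` solvable_rhs m A r = {..<m} \<rightarrow>\<^sub>E ?S"
    proof (intro equalityI subsetI)
      fix f assume "f \<in> (\<lambda>B. restrict (col B) {..<m}) ` solvable_rhs m A r"
      then obtain B X where B: "B \<in> int_box n m r" "f = restrict (col B) {..<m}"
        and X: "X \<in> carrier_mat k m" "A * X = B"
        using A by (auto simp: solvable_rhs_def)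
      have "col B j \<in> ?S" if j: "j < m" for j
      proof -
        have "col B j = A *\<^sub>v col X j" using col_mult2[OF A X(1) j] X(2) by simp
        moreover have "col X j \<in> carrier_vec k" using X by auto
        ultimately have "col B j \<in> column_lattice A" using A by (auto simp: column_lattice_def)
        then show ?thesis using B j by (auto simp: int_box_def)
      qed
      then show "f \<in> {..<m} \<rightarrow>\<^sub>E ?S" by (simp add: B(2))
    next
      fix f assume f: "f \<in> {..<m} \<rightarrow>\<^sub>E ?S"
      have "\<exists>v. v \<in> carrier_vec k \<and> f j = A *\<^sub>v v" if "j < m" for j
        using PiE_mem[OF f, of j] that A by (auto simp: column_lattice_def)
      then obtain v where v: "\<And>j. j < m \<Longrightarrow> v j \<in> carrier_vec k \<and> f j = A *\<^sub>v v j"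
        by metis
      let ?B = "mat n m (\<lambda>(i, j). f j $ i)"
      have "A * mat k m (\<lambda>(i, j). v j $ i) = mat n m (\<lambda>(i, j). (A *\<^sub>v v j) $ i)"
        using v by (intro mult_mat_cols[OF A]) auto
      also have "\<dots> = ?B" using v by (intro eq_matI) auto
      finally have "\<exists>X \<in> carrier_mat (dim_col A) m. A * X = ?B"
        using A by (intro bexI) auto
      moreover have "?B \<in> int_box n m r"
        using f by (auto simp: int_box_def dest!: PiE_mem)
      ultimately have B: "?B \<in> solvable_rhs m A r" using A by (simp add: solvable_rhs_def)
      have "f = restrict (col ?B) {..<m}"
      proof
        fix j
        have "col ?B j = f j" if "j < m"
          using S_carrier[OF PiE_mem[OF f, of j]] that by (intro eq_vecI) auto
        then show "f j = restrict (col ?B) {..<m} j"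
          using PiE_arb[OF f, of j] by (cases "j < m") simp_all
      qed
      with B show "f \<in> (\<lambda>B. restrict (col B) {..<m}) ` solvable_rhs m A r" by blast
    qed
  qed
  from bij_betw_same_card[OF this] show ?thesis by (simp add: card_PiE)
qed

lemma card_SAT_box:
  "card (SAT m k n \<inter> int_box n (k + m) r) = (\<Sum>A\<in>int_box n k r. card (solvable_rhs m A r))"
proof -
  have "bij_betw (\<lambda>(A, B). augmented_mat A B) (Sigma (int_box n k r) (\<lambda>A. solvable_rhs m A r))
      (SAT m k n \<inter> int_box n (k + m) r)"
  proof (rule bij_betw_imageI)
    show "inj_on (\<lambda>(A, B). augmented_mat A B) (Sigma (int_box n k r) (\<lambda>A. solvable_rhs m A r))"
    proof (rule inj_onI, clarify)
      fix A B C D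
      assume AC: "A \<in> int_box n k r" "C \<in> int_box n k r"
        and BD: "B \<in> solvable_rhs m A r" "D \<in> solvable_rhs m C r"
        and eq: "augmented_mat A B = augmented_mat C D"
      have c: "A \<in> carrier_mat n k" "B \<in> carrier_mat n m" "C \<in> carrier_mat n k" "D \<in> carrier_mat n m"
        using AC BD by (auto simp: solvable_rhs_def int_box_def)
      have entry: "(if j < k then A $$ (i, j) else B $$ (i, j - k))
          = (if j < k then C $$ (i, j) else D $$ (i, j - k))" if "i < n" "j < k + m" for i j
        using augmented_mat_index[OF c(1,2) that] augmented_mat_index[OF c(3,4) that] eq by simp
      have "A $$ (i, j) = C $$ (i, j)" if "i < n" "j < k" for i j
        using entry[of i j] that by simp
      moreover have "B $$ (i, j) = D $$ (i, j)" if "i < n" "j < m" for i j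
        using entry[of i "k + j"] that by simp
      ultimately show "A = C \<and> B = D" using c by (intro conjI eq_matI) auto
    qed
    have box: "augmented_mat A B \<in> int_box n (k + m) r \<longleftrightarrow> A \<in> int_box n k r \<and> B \<in> int_box n m r"
      if c: "A \<in> carrier_mat n k" "B \<in> carrier_mat n m" for A B
    proof
      assume L: "augmented_mat A B \<in> int_box n (k + m) r"
      have "\<bar>A $$ (i, j)\<bar> \<le> int r" if "i < n" "j < k" for i j
      proof -
        have "\<bar>augmented_mat A B $$ (i, j)\<bar> \<le> int r" using L that by (simp add: int_box_def)
        then show ?thesis using augmented_mat_index[OF c, of i j] that by simp
      qed
      moreover have "\<bar>B $$ (i, j)\<bar> \<le> int r" if "i < n" "j < m" for i j
      proof -
        have "\<bar>augmented_mat A B $$ (i, k + j)\<bar> \<le> int r" using L that by (simp add: int_box_def)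
        then show ?thesis using augmented_mat_index[OF c, of i "k + j"] that by simp
      qed
      ultimately show "A \<in> int_box n k r \<and> B \<in> int_box n m r" using c by (simp add: int_box_def)
    next
      assume "A \<in> int_box n k r \<and> B \<in> int_box n m r"
      then show "augmented_mat A B \<in> int_box n (k + m) r"
        using augmented_mat_carrier[OF c] augmented_mat_index[OF c] by (simp add: int_box_def)
    qed
    show "(\<lambda>(A, B). augmented_mat A B) ` Sigma (int_box n k r) (\<lambda>A. solvable_rhs m A r)
        = SAT m k n \<inter> int_box n (k + m) r"
    proof (intro equalityI subsetI)
      fix M assume "M \<in> (\<lambda>(A, B). augmented_mat A B) ` Sigma (int_box n k r) (\<lambda>A. solvable_rhs m A r)"
      then obtain A B where M: "M = augmented_mat A B" and A: "A \<in> int_box n k r"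
        and B: "B \<in> solvable_rhs m A r" by auto
      have c: "A \<in> carrier_mat n k" using A by (simp add: int_box_def)
      then have B': "B \<in> int_box n m r" "\<exists>X \<in> carrier_mat k m. A * X = B"
        using B by (auto simp: solvable_rhs_def)
      then have "B \<in> carrier_mat n m" by (simp add: int_box_def)
      with c A B' M box show "M \<in> SAT m k n \<inter> int_box n (k + m) r" unfolding SAT_def by blast
    next
      fix M assume "M \<in> SAT m k n \<inter> int_box n (k + m) r"
      then obtain A B where M: "M = augmented_mat A B" "M \<in> int_box n (k + m) r"
        and c: "A \<in> carrier_mat n k" "B \<in> carrier_mat n m" and X: "\<exists>X \<in> carrier_mat k m. A * X = B"
        unfolding SAT_def by blast
      with box[OF c] have "A \<in> int_box n k r" "B \<in> int_box n m r" by auto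
      moreover from this X c have "B \<in> solvable_rhs m A r" by (simp add: solvable_rhs_def)
      ultimately show "M \<in> (\<lambda>(A, B). augmented_mat A B) `
          Sigma (int_box n k r) (\<lambda>A. solvable_rhs m A r)" using M(1) by force
    qed
  qed
  from bij_betw_same_card[OF this] show ?thesis
    by (simp add: card_SigmaI finite_int_box solvable_rhs_def)
qed

text \<open>
Rank-deficient matrices may be included: for them the gcd is zero, and so is \<open>(1 / 0) ^ m\<close>,
as \<open>m\<close> is positive. The same convention occurs in the lattice point estimate, so both sums
then run over the same matrices.
\<close>

lemma gcd_sum_eq_sum_box:
  assumes "m > 0"
  shows "gcd_sum m k n r = (\<Sum>A\<in>int_box n k r. (1 / of_int (greatest_divisor A)) ^ m)"
proof -
  have "gcd_sum m k n r = (\<Sum>A \<in> {A \<in> int_box n k r. int_rank A = n}. (1 / of_int (greatest_divisor A)) ^ m)"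
    unfolding gcd_sum_def by (simp add: power_int_minus power_one_over inverse_eq_divide)
  also have "\<dots> = (\<Sum>A\<in>int_box n k r. (1 / of_int (greatest_divisor A)) ^ m)"
  proof (rule sum.mono_neutral_left[OF finite_int_box])
    show "\<forall>A \<in> int_box n k r - {A \<in> int_box n k r. int_rank A = n}.
        (1 / real_of_int (greatest_divisor A)) ^ m = 0"
      using assms greatest_divisor_eq_0_if_rank_deficient[of _ n k] by (auto simp: int_box_def)
  qed auto
  finally show ?thesis .
qed

lemma solvable_rhs_density:
  assumes A: "A \<in> carrier_mat n k" and "n \<le> k"
  shows "\<bar>real (card (solvable_rhs m A r)) / (2 * real r + 1) ^ (n * m)
      - (1 / of_int (greatest_divisor A)) ^ m\<bar> \<le> real m * (real n / (2 * real r + 1))"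
proof -
  interpret zlattice n "column_lattice A" by (rule zlattice_column_lattice[OF A])
  define N where "N = 2 * real r + 1"
  define c where "c = card {x \<in> column_lattice A. \<forall>j<n. \<bar>x $ j\<bar> \<le> int r}"
  define g where "g = greatest_divisor A"
  have N: "N > 0" by (simp add: N_def)
  have "real c \<le> real ((2 * r + 1) ^ n)" using box_card_le[of r] unfolding c_def of_nat_le_iff .
  also have "\<dots> = N ^ n" by (simp add: N_def add.commute)
  finally have c: "norm (real c / N ^ n) \<le> 1" using N by simp
  have "g \<ge> 0" by (simp add: g_def greatest_divisor_def)
  then have g: "norm (1 / real_of_int g) \<le> 1" by (cases "g = 0") simp_all
  have "real (card (solvable_rhs m A r)) / N ^ (n * m) = (real c / N ^ n) ^ m"
    by (simp add: card_solvable_rhs[OF A] c_def power_divide power_mult)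
  then have "\<bar>real (card (solvable_rhs m A r)) / N ^ (n * m) - (1 / of_int g) ^ m\<bar>
      = norm ((real c / N ^ n) ^ m - (1 / real_of_int g) ^ m)"
    by simp
  \<comment> \<open>On the unit interval, taking \<open>m\<close>-th powers is Lipschitz with constant \<open>m\<close>.\<close>
  also have "\<dots> \<le> real m * norm (real c / N ^ n - 1 / real_of_int g)"
    by (rule norm_power_diff[OF c g])
  also have "\<dots> \<le> real m * (real n / N)"
    using box_density[of r]
    by (intro mult_left_mono) (simp_all add: N_def c_def g_def greatest_divisor_eq_prod_pivot[OF assms])
  finally show ?thesis by (simp add: N_def g_def)
qed

text \<open>
Averaging \<open>solvable_rhs_density\<close> over all coefficient matrices in the box preserves the
error bound, since it is the same for all of them.
\<close>

lemma SAT_density_approx: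
  assumes "m > 0" and "n \<le> k"
  shows "\<bar>real (card (SAT m k n \<inter> int_box n (k + m) r)) / real (card (int_box n (k + m) r))
      - gcd_sum m k n r / (2 * real r + 1) ^ (n * k)\<bar> \<le> real m * real n / (2 * real r + 1)"
proof -
  define N where "N = 2 * real r + 1"
  have N: "N > 0" by (simp add: N_def)
  have card_box: "real (card (int_box n l r)) = N ^ (n * l)" for l
    by (simp add: card_int_box N_def add.commute)
  let ?f = "\<lambda>A. real (card (solvable_rhs m A r)) / N ^ (n * m)"
  let ?g = "\<lambda>A. (1 / real_of_int (greatest_divisor A)) ^ m"
  have "real (card (SAT m k n \<inter> int_box n (k + m) r)) / real (card (int_box n (k + m) r))
      = (\<Sum>A\<in>int_box n k r. ?f A) / N ^ (n * k)"
    by (simp add: card_SAT_box card_box distrib_left power_add sum_divide_distrib mult.commute)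
  then have "\<bar>real (card (SAT m k n \<inter> int_box n (k + m) r)) / real (card (int_box n (k + m) r))
      - gcd_sum m k n r / N ^ (n * k)\<bar> = \<bar>\<Sum>A\<in>int_box n k r. ?f A - ?g A\<bar> / N ^ (n * k)"
    using N by (simp add: gcd_sum_eq_sum_box[OF assms(1)] sum_subtractf diff_divide_distrib[symmetric])
  also have "\<dots> \<le> (\<Sum>A\<in>int_box n k r. real m * (real n / N)) / N ^ (n * k)"
  proof (intro divide_right_mono order_trans[OF sum_abs] sum_mono)
    fix A assume "A \<in> int_box n k r"
    then show "\<bar>?f A - ?g A\<bar> \<le> real m * (real n / N)"
      using solvable_rhs_density[OF _ assms(2)] by (simp add: int_box_def N_def)
  qed (use N in simp)
  also have "\<dots> = real m * real n / N"
    using N by (simp add: card_box)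
  finally show ?thesis by (simp add: N_def)
qed

section \<open>Comparison of the limits\<close>

lemma gcd_sum_bounds:
  assumes "m > 0"
  shows "0 \<le> gcd_sum m k n r" "gcd_sum m k n r \<le> (2 * real r + 1) ^ (n * k)"
proof -
  have g: "0 \<le> greatest_divisor A" for A by (simp add: greatest_divisor_def)
  then show "0 \<le> gcd_sum m k n r"
    by (auto simp: gcd_sum_eq_sum_box[OF assms] intro!: sum_nonneg)
  have "gcd_sum m k n r \<le> (\<Sum>A\<in>int_box n k r. 1)"
    unfolding gcd_sum_eq_sum_box[OF assms]
  proof (rule sum_mono)
    fix A
    have "1 / real_of_int (greatest_divisor A) \<le> 1"
      using g[of A] by (cases "greatest_divisor A = 0") simp_all
    then show "(1 / real_of_int (greatest_divisor A)) ^ m \<le> 1"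
      using g[of A] by (intro power_le_one) simp_all
  qed
  then show "gcd_sum m k n r \<le> (2 * real r + 1) ^ (n * k)"
    by (simp add: card_int_box add.commute)
qed

theorem theorem5p6:
  fixes m k n :: nat and \<rho> :: real
  assumes "m > 0" and "k > 0" and "n > 0" and "n \<le> k"
  shows "has_asymptotic_density n (k + m) (SAT m k n) \<rho> \<longleftrightarrow>
    (\<lambda>r. gcd_sum m k n r / (2 * real r) ^ (n * k)) \<longlonglongrightarrow> \<rho>"
proof -
  define u where "u r = real (card (SAT m k n \<inter> int_box n (k + m) r)) /
    real (card (int_box n (k + m) r))" for r
  define F where "F r = gcd_sum m k n r / (2 * real r + 1) ^ (n * k)" for r
  define w where "w r = gcd_sum m k n r / (2 * real r) ^ (n * k)" for r
  have inv: "(\<lambda>r. 1 / (2 * real r + 1)) \<longlonglongrightarrow> 0" "(\<lambda>r. 1 / (2 * real r)) \<longlonglongrightarrow> 0"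
    by (rule real_tendsto_divide_at_top[OF tendsto_const],
        rule filterlim_at_top_mono[OF filterlim_real_sequentially], simp)+
  have uF: "(\<lambda>r. u r - F r) \<longlonglongrightarrow> 0"
  proof (rule tendsto_0_le[OF inv(1)])
    show "\<forall>\<^sub>F r in sequentially. norm (u r - F r) \<le> norm (1 / (2 * real r + 1)) * (real m * real n)"
      using SAT_density_approx[OF assms(1,4)] by (simp add: u_def F_def)
  qed
  \<comment> \<open>Replacing \<open>2 * r + 1\<close> by \<open>2 * r\<close> does not matter in the limit, since \<open>F\<close> is bounded.\<close>
  have wF: "(\<lambda>r. w r - F r) \<longlonglongrightarrow> 0"
  proof (rule tendsto_0_le)
    have "(\<lambda>r. (1 + 1 / (2 * real r)) ^ (n * k) - 1) \<longlonglongrightarrow> (1 + 0) ^ (n * k) - 1"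
      by (intro tendsto_intros inv)
    then show "(\<lambda>r. (1 + 1 / (2 * real r)) ^ (n * k) - 1) \<longlonglongrightarrow> 0" by simp
    have "norm (w r - F r) \<le> norm ((1 + 1 / (2 * real r)) ^ (n * k) - 1) * 1" if "r > 0" for r
    proof -
      have F: "0 \<le> F r" "F r \<le> 1"
        using gcd_sum_bounds[OF assms(1), of k n r] by (simp_all add: F_def)
      have "1 + 1 / (2 * real r) = (2 * real r + 1) / (2 * real r)"
        using that by (simp add: field_simps)
      then have "w r = F r * (1 + 1 / (2 * real r)) ^ (n * k)"
        by (simp add: w_def F_def power_divide)
      then have "w r - F r = F r * ((1 + 1 / (2 * real r)) ^ (n * k) - 1)"
        by (simp add: algebra_simps)
      moreover have "1 \<le> (1 + 1 / (2 * real r)) ^ (n * k)"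
        by (rule one_le_power) simp
      ultimately show ?thesis using F by (simp add: abs_mult mult_left_le_one_le)
    qed
    then show "\<forall>\<^sub>F r in sequentially. norm (w r - F r) \<le> norm ((1 + 1 / (2 * real r)) ^ (n * k) - 1) * 1"
      using eventually_gt_at_top by (rule eventually_mono[rotated])
  qed
  have uw: "(\<lambda>r. u r - w r) \<longlonglongrightarrow> 0" using tendsto_diff[OF uF wF] by simp
  have "u \<longlonglongrightarrow> \<rho> \<longleftrightarrow> w \<longlonglongrightarrow> \<rho>"
    using Lim_transform[OF _ uw, of \<rho>] Lim_transform2[OF _ uw, of \<rho>] by blast
  then show ?thesis by (simp add: has_asymptotic_density_def u_def[abs_def] w_def[abs_def])
qed

end
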